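(* Let $(\mathcal{T}_n)_{n\ge1}$ be a sequence of size-conditioned simply generated trees of type I, II or III, and let $v_n$ be a uniformly chosen vertex of $\mathcal{T}_n$. Then there exist constants $n_0\ge1$ and $C,c>0$, depending only on the weight sequence, such that \[ \mathbf P\bigl(\partial_{\mathrm p}(\mathcal{T}_n,v_n)\ge k\bigr)\le Ce^{-ck}\qquad\text{for any } n\ge n_0 \text{ (for which }\mathcal{T}_n\text{ is defined) and any } k\ge0. \]
   Context: **Simply generated trees.** A weight sequence is a sequence $\mathbf w=(\omega_k)_{k\ge0}$ of non-negative reals with $\omega_0>0$ and $\omega_k>0$ for at least one $k\ge2$. For $n\ge 1$, $\mathcal{T}_n$ is the random rooted plane tree with $n$ vertices such that $\mathbf P(\mathcal{T}_n=T)$ is proportional to $\prod_{v\in T}\omega_{d_T^+(v)}$ for each $n$-vertex rooted plane tree $T$, where $d_T^+(v)$ is the outdegree (number of children) of $v$. Throughout, only those $n$ are considered for which some $n$-vertex tree has positive weight ("$\mathcal{T}_n$ is defined"). The vertex $v_n$ is uniform among the vertices of $\mathcal{T}_n$, conditionally on $\mathcal{T}_n$. **Types.** Let $\Phi(z)=\sum_{k\ge0}\omega_kz^k$ with radius of convergence $R\in[0,\infty]$. Type I: there is a (finite) $\tau\in(0,R]$ with $\Phi(\tau)<\infty$ and $\tau\Phi'(\tau)/\Phi(\tau)=1$. Type II: $R>0$, $\Phi(R)<\infty$ and $R\Phi'(R)/\Phi(R)<1$. Type III: $R=0$. **Protection number.** A leaf is a vertex with no children. For a vertex $v$ of a finite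 rooted tree $T$, the fringe subtree of $T$ at $v$ is the subtree consisting of $v$ and all its descendants, rooted at $v$; the protection number $\partial_{\mathrm p}(T,v)$ is the minimal graph distance from $v$ to a leaf of this fringe subtree. *)

theory Defs
  imports "HOL-Analysis.Analysis" "HOL-Probability.Probability_Mass_Function"
begin

section \<open>Rooted plane trees\<close>

datatype plane_tree = PTree (subtrees: "plane_tree list")

text \<open>
  Vertices are addressed in the Ulam--Harris way: the root is \<open>[]\<close>, and the \<open>i\<close>-th child
  (counted from 0) of the vertex \<open>v\<close> is \<open>v @ [i]\<close>.
\<close>

fun is_vertex :: "plane_tree \<Rightarrow> nat list \<Rightarrow> bool" where
  "is_vertex (PTree ts) [] = True"
| "is_vertex (PTree ts) (i # v) = (i < length ts \<and> is_vertex (ts ! i) v)"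

definition vertices :: "plane_tree \<Rightarrow> nat list set" where
  "vertices T = {v. is_vertex T v}"

definition tree_order :: "plane_tree \<Rightarrow> nat" where
  "tree_order T = card (vertices T)"

text \<open>
  The fringe subtree of \<open>T\<close> at \<open>v\<close>; only meaningful for \<open>v \<in> vertices T\<close>. Its vertices are
  addressed relative to its own root, so the address \<open>[]\<close> stands for \<open>v\<close> itself.
\<close>

fun fringe_subtree :: "plane_tree \<Rightarrow> nat list \<Rightarrow> plane_tree" where
  "fringe_subtree T [] = T"
| "fringe_subtree (PTree ts) (i # v) = fringe_subtree (ts ! i) v"

definition outdegree :: "plane_tree \<Rightarrow> nat list \<Rightarrow> nat" where
  "outdegree T v = length (subtrees (fringe_subtree T v))"

definition leaves :: "plane_tree \<Rightarrow> nat list set" where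
  "leaves T = {v \<in> vertices T. outdegree T v = 0}"

definition edges :: "plane_tree \<Rightarrow> (nat list \<times> nat list) set" where
  "edges T = {(u, v). u \<in> vertices T \<and> v \<in> vertices T \<and> (\<exists>i. v = u @ [i] \<or> u = v @ [i])}"

definition graph_dist :: "plane_tree \<Rightarrow> nat list \<Rightarrow> nat list \<Rightarrow> nat" where
  "graph_dist T u v = (LEAST d. (u, v) \<in> edges T ^^ d)"

definition protection_number :: "plane_tree \<Rightarrow> nat list \<Rightarrow> nat" where
  "protection_number T v =
     Min (graph_dist (fringe_subtree T v) [] ` leaves (fringe_subtree T v))"


section \<open>Weight sequences and their types\<close>

definition weight_sequence :: "(nat \<Rightarrow> real) \<Rightarrow> bool" where
  "weight_sequence w \<longleftrightarrow> (\<forall>k. w k \<ge> 0) \<and> w 0 > 0 \<and> (\<exists>k\<ge>2. w k > 0)"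

definition gen_fun :: "(nat \<Rightarrow> real) \<Rightarrow> real \<Rightarrow> real" where
  "gen_fun w z = (\<Sum>k. w k * z ^ k)"

text \<open>
  The derivative is the termwise differentiated power series. At \<open>z = R\<close>, the radius of
  convergence, this series is what the derivative means; it may then be infinite, which is why
  the types below require summability explicitly.
\<close>

definition gen_fun_deriv :: "(nat \<Rightarrow> real) \<Rightarrow> real \<Rightarrow> real" where
  "gen_fun_deriv w z = (\<Sum>k. diffs w k * z ^ k)"

text \<open>
  The two summability conditions say that the value and the derivative are finite. Finiteness of the
  derivative is implicit in its quotient being equal to, or less than, 1. In type II, a weight
  sequence cannot have infinite radius of convergence, because the value at infinity would
  be infinite.
\<close>

definition type_I :: "(nat \<Rightarrow> real) \<Rightarrow> bool" where
  "type_I w \<longleftrightarrow> (\<exists>\<tau>::real. 0 < \<tau> \<and> ereal \<tau> \<le> conv_radius w \<and>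
     summable (\<lambda>k. w k * \<tau> ^ k) \<and> summable (\<lambda>k. diffs w k * \<tau> ^ k) \<and>
     \<tau> * gen_fun_deriv w \<tau> / gen_fun w \<tau> = 1)"

definition type_II :: "(nat \<Rightarrow> real) \<Rightarrow> bool" where
  "type_II w \<longleftrightarrow> (\<exists>R::real. 0 < R \<and> conv_radius w = ereal R \<and>
     summable (\<lambda>k. w k * R ^ k) \<and> summable (\<lambda>k. diffs w k * R ^ k) \<and>
     R * gen_fun_deriv w R / gen_fun w R < 1)"

definition type_III :: "(nat \<Rightarrow> real) \<Rightarrow> bool" where
  "type_III w \<longleftrightarrow> conv_radius w = 0"


section \<open>Simply generated trees\<close>

definition tree_weight :: "(nat \<Rightarrow> real) \<Rightarrow> plane_tree \<Rightarrow> real" where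
  "tree_weight w T = (\<Prod>v\<in>vertices T. w (outdegree T v))"

definition partition_function :: "(nat \<Rightarrow> real) \<Rightarrow> nat \<Rightarrow> real" where
  "partition_function w n = (\<Sum>T | tree_order T = n. tree_weight w T)"

definition sgt_defined :: "(nat \<Rightarrow> real) \<Rightarrow> nat \<Rightarrow> bool" where
  "sgt_defined w n \<longleftrightarrow> (\<exists>T. tree_order T = n \<and> tree_weight w T > 0)"

text \<open>Only meaningful if \<open>sgt_defined w n\<close>; see \<open>pmf_simply_generated_tree\<close> below.\<close>

definition simply_generated_tree :: "(nat \<Rightarrow> real) \<Rightarrow> nat \<Rightarrow> plane_tree pmf" where
  "simply_generated_tree w n = embed_pmf
     (\<lambda>T. if tree_order T = n then tree_weight w T / partition_function w n else 0)"

text \<open>The joint law of the random tree and a vertex of it chosen uniformly given the tree.\<close>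

definition sgt_with_vertex :: "(nat \<Rightarrow> real) \<Rightarrow> nat \<Rightarrow> (plane_tree \<times> nat list) pmf" where
  "sgt_with_vertex w n =
     bind_pmf (simply_generated_tree w n) (\<lambda>T. map_pmf (Pair T) (pmf_of_set (vertices T)))"


section \<open>The laws above are well defined\<close>

lemma vertices_PTree:
  "vertices (PTree ts) = insert [] (\<Union>i<length ts. (#) i ` vertices (ts ! i))"
proof (rule set_eqI)
  fix v show "v \<in> vertices (PTree ts) \<longleftrightarrow>
      v \<in> insert [] (\<Union>i<length ts. (#) i ` vertices (ts ! i))"
    by (cases v) (auto simp: vertices_def)
qed

lemma root_in_vertices [simp]: "[] \<in> vertices T"
  by (cases T) (simp add: vertices_PTree)

lemma finite_vertices [simp]: "finite (vertices T)"
  by (induction T) (simp add: vertices_PTree)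

lemma tree_order_subtree:
  assumes "t \<in> set ts"
  shows "tree_order t < tree_order (PTree ts)"
proof -
  obtain i where i: "i < length ts" "t = ts ! i"
    using assms by (metis in_set_conv_nth)
  have "card (vertices t) = card ((#) i ` vertices t)"
    by (simp add: card_image)
  also have "\<dots> < card (vertices (PTree ts))"
    by (rule psubset_card_mono) (use i in \<open>auto simp: vertices_PTree\<close>)
  finally show ?thesis by (simp add: tree_order_def)
qed

lemma length_less_tree_order: "length ts < tree_order (PTree ts)"
proof -
  have "length ts = card ((\<lambda>i. [i]) ` {..<length ts})"
    by (simp add: card_image inj_on_def)
  also have "\<dots> < card (vertices (PTree ts))"
    by (rule psubset_card_mono) (auto simp: vertices_PTree)
  finally show ?thesis by (simp add: tree_order_def)
qed

lemma finite_tree_order_le: "finite {T. tree_order T \<le> n}"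
proof (induction n)
  case 0
  have "tree_order T > 0" for T
    by (cases T) (metis length_less_tree_order gr_zeroI not_less_zero)
  then have "{T. tree_order T \<le> 0} = {}" by (auto dest: leD)
  then show ?case by (metis finite.emptyI)
next
  case (Suc n)
  let ?A = "{T. tree_order T \<le> n}"
  have "{T. tree_order T \<le> Suc n} \<subseteq> PTree ` {ts. set ts \<subseteq> ?A \<and> length ts \<le> n}"
  proof
    fix T assume T: "T \<in> {T. tree_order T \<le> Suc n}"
    obtain ts where ts: "T = PTree ts" by (cases T)
    have "set ts \<subseteq> ?A" "length ts \<le> n"
      using T tree_order_subtree[of _ ts] length_less_tree_order[of ts]
      unfolding ts by (force, simp)
    then show "T \<in> PTree ` {ts. set ts \<subseteq> ?A \<and> length ts \<le> n}"
      using ts by blast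
  qed
  moreover have "finite (PTree ` {ts. set ts \<subseteq> ?A \<and> length ts \<le> n})"
    by (intro finite_imageI finite_lists_length_le Suc.IH)
  ultimately show ?case by (rule finite_subset)
qed

lemma finite_tree_order [simp]: "finite {T. tree_order T = n}"
  by (rule finite_subset[OF _ finite_tree_order_le[of n]]) auto

lemma tree_weight_nonneg: "weight_sequence w \<Longrightarrow> tree_weight w T \<ge> 0"
  by (auto simp: tree_weight_def weight_sequence_def intro!: prod_nonneg)

lemma partition_function_pos:
  assumes "weight_sequence w" "sgt_defined w n"
  shows "partition_function w n > 0"
  using assms unfolding partition_function_def sgt_defined_def
  by (auto intro!: sum_pos2 tree_weight_nonneg)

lemma pmf_simply_generated_tree:
  assumes "weight_sequence w" "sgt_defined w n"
  shows "pmf (simply_generated_tree w n) T =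
           (if tree_order T = n then tree_weight w T / partition_function w n else 0)"
  unfolding simply_generated_tree_def
proof (rule pmf_embed_pmf)
  let ?f = "\<lambda>T. if tree_order T = n then tree_weight w T / partition_function w n else 0"
  note pos = partition_function_pos[OF assms]
  show nonneg: "?f T \<ge> 0" for T
    using pos tree_weight_nonneg[OF assms(1)] by simp
  have "(\<integral>\<^sup>+T. ennreal (?f T) \<partial>count_space UNIV) =
        (\<Sum>T | tree_order T = n. ennreal (?f T))"
    by (rule nn_integral_count_space') auto
  also have "\<dots> = ennreal (\<Sum>T | tree_order T = n. ?f T)"
    by (rule sum_ennreal) (rule nonneg)
  also have "(\<Sum>T | tree_order T = n. ?f T) = 1"
    using pos by (simp add: partition_function_def flip: sum_divide_distrib)
  finally show "(\<integral>\<^sup>+T. ennreal (?f T) \<partial>count_space UNIV) = 1" by simp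
qed

end

theory Submission
  imports Defs
begin

text \<open>
  List the outdegrees of a tree in depth-first order. By the cycle lemma, a tree of order \<open>n\<close> together
  with a vertex corresponds, by rotating this list so that it starts at the vertex, to an arbitrary
  list of \<open>n\<close> numbers with sum \<open>n - 1\<close>, and the weight is the product of the weights of the entries.
  Following first children from a vertex of protection number at least \<open>k\<close> shows that the first
  \<open>k\<close> entries of its list are nonzero. Random lists are exchangeable, so on the event that at least
  \<open>\<delta> n\<close> entries are zero this has probability at most \<open>(1 - \<delta>)\<^sup>k\<close>. Lists with fewer zeros
  consist mostly of ones; replacing \<open>K\<close> ones by one \<open>K\<close> and \<open>K - 1\<close> zeros, where \<open>K \<ge> 2\<close> has
  positive weight, shows that their total weight is exponentially small in \<open>n\<close>.
\<close>

section \<open>Preorder codes of plane trees\<close>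

fun fringe_list :: "plane_tree \<Rightarrow> plane_tree list" where
  "fringe_list (PTree ts) = PTree ts # concat (map fringe_list ts)"

text \<open>The Lukasiewicz word of the tree. Entry i belongs to the same vertex as entry i of
  \<open>fringe_list T\<close>, so positions can replace vertex addresses.\<close>

fun code :: "plane_tree \<Rightarrow> nat list" where
  "code (PTree ts) = length ts # concat (map code ts)"

lemma code_nonempty [simp]: "code T \<noteq> []"
  by (cases T) simp

text \<open>Height change of the Lukasiewicz walk, whose step at an entry x is x - 1; integer-valued
  because leaves step down.\<close>

definition excess :: "nat list \<Rightarrow> int" where
  "excess s = (\<Sum>x\<leftarrow>s. int x - 1)"

lemma excess_simps [simp]:
  "excess [] = 0" "excess (x # s) = int x - 1 + excess s" "excess (s @ t) = excess s + excess t"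
  by (simp_all add: excess_def)

lemma excess_eq: "excess s = int (sum_list s) - int (length s)"
  by (induction s) auto

text \<open>Counts and products over vertices can be read off multisets, which avoids an explicit
  bijection between addresses and positions.\<close>

lemma image_mset_fringe_subtree:
  "image_mset (fringe_subtree T) (mset_set (vertices T)) = mset (fringe_list T)"
proof (induction T)
  case (PTree ts)
  have *: "image_mset (fringe_subtree (PTree ts)) (mset_set ((#) i ` vertices (ts ! i)))
            = mset (fringe_list (ts ! i))" if "i < length ts" for i
  proof -
    have "image_mset (fringe_subtree (PTree ts)) (mset_set ((#) i ` vertices (ts ! i)))
        = image_mset (fringe_subtree (PTree ts)) (image_mset ((#) i) (mset_set (vertices (ts ! i))))"
      by (subst image_mset_mset_set) auto
    also have "\<dots> = image_mset (fringe_subtree (ts ! i)) (mset_set (vertices (ts ! i)))"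
      by (simp add: multiset.map_comp o_def)
    finally show ?thesis using PTree that by simp
  qed
  \<comment> \<open>The address sets of the children are disjoint, as addresses begin with the child
    index; the children are added one at a time.\<close>
  have union: "image_mset (fringe_subtree (PTree ts)) (mset_set (\<Union>i<m. (#) i ` vertices (ts ! i)))
        = mset (concat (map fringe_list (take m ts)))" if "m \<le> length ts" for m
    using that
  proof (induction m)
    case (Suc m)
    have "mset_set (\<Union>i<Suc m. (#) i ` vertices (ts ! i))
        = mset_set (\<Union>i<m. (#) i ` vertices (ts ! i)) + mset_set ((#) m ` vertices (ts ! m))"
      by (subst mset_set_Union [symmetric]) (auto simp: lessThan_Suc Un_commute)
    with Suc show ?case
      by (simp add: * take_Suc_conv_app_nth)
  qed auto
  have "mset_set (vertices (PTree ts))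
      = add_mset [] (mset_set (\<Union>i<length ts. (#) i ` vertices (ts ! i)))"
    unfolding vertices_PTree by (subst mset_set.insert) auto
  then show ?case using union[of "length ts"] by simp
qed

lemma length_fringe_list: "length (fringe_list T) = tree_order T"
  using arg_cong[OF image_mset_fringe_subtree, of size T] by (simp add: tree_order_def)

lemma code_fringe_list: "code T = map (\<lambda>t. length (subtrees t)) (fringe_list T)"
proof (induction T)
  case (PTree ts)
  have "map code ts = map (map (\<lambda>t. length (subtrees t)) \<circ> fringe_list) ts"
    using PTree by simp
  then show ?case by (simp only: code.simps fringe_list.simps map_concat list.map plane_tree.sel map_map)
qed

lemma length_code: "length (code T) = tree_order T"
  by (simp add: code_fringe_list length_fringe_list)

lemma tree_weight_code: "tree_weight w T = (\<Prod>x\<leftarrow>code T. w x)"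
proof -
  have "tree_weight w T
      = prod_mset (image_mset (\<lambda>t. w (length (subtrees t)))
          (image_mset (fringe_subtree T) (mset_set (vertices T))))"
    by (simp add: tree_weight_def outdegree_def prod_unfold_prod_mset multiset.map_comp o_def)
  also have "\<dots> = (\<Prod>x\<leftarrow>code T. w x)"
    by (simp add: image_mset_fringe_subtree code_fringe_list o_def flip: prod_mset_prod_list mset_map)
  finally show ?thesis .
qed

lemma card_vertices_fringe_subtree:
  "card {v \<in> vertices T. Q (fringe_subtree T v)} = card {i. i < tree_order T \<and> Q (fringe_list T ! i)}"
proof -
  have "card {v \<in> vertices T. Q (fringe_subtree T v)}
      = size (filter_mset Q (image_mset (fringe_subtree T) (mset_set (vertices T))))"
    by (simp add: filter_mset_image_mset)
  also have "\<dots> = length (filter Q (fringe_list T))"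
    unfolding image_mset_fringe_subtree by (metis mset_filter size_mset)
  finally show ?thesis by (simp add: length_filter_conv_card length_fringe_list)
qed

text \<open>Preorder lists every fringe subtree as a contiguous block that begins with its
  root.\<close>

lemma drop_code:
  "i < length (fringe_list T) \<Longrightarrow> \<exists>r. drop i (code T) = code (fringe_list T ! i) @ r"
proof (induction T arbitrary: i)
  case (PTree ts)
  show ?case
  proof (cases i)
    case (Suc i')
    \<comment> \<open>Position \<open>i'\<close> falls into the block of the first child, or is
      shifted by the length of that block into the blocks of the others.\<close>
    have "i' < length (concat (map fringe_list ts)) \<Longrightarrow>
        \<exists>r. drop i' (concat (map code ts)) = code (concat (map fringe_list ts) ! i') @ r"
      using PTree.IH
    proof (induction ts arbitrary: i')
      case (Cons t ts)
      have len: "length (code t) = length (fringe_list t)"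
        by (simp add: code_fringe_list)
      show ?case
      proof (cases "i' < length (fringe_list t)")
        case True
        then obtain r where "drop i' (code t) = code (fringe_list t ! i') @ r"
          using Cons.prems by force
        then show ?thesis using True len by (simp add: nth_append)
      next
        case False
        then show ?thesis
          using Cons.IH[of "i' - length (fringe_list t)"] Cons.prems len by (simp add: nth_append)
      qed
    qed simp
    then show ?thesis using PTree.prems Suc by simp
  qed simp
qed

text \<open>Preorder first descends through first children, so every entry before the leftmost leaf,
  at depth j, is a positive outdegree.\<close>

lemma leftmost_leaf:
  "\<exists>j. j < length (code T) \<and> (\<forall>i<j. code T ! i \<noteq> 0) \<and> replicate j 0 \<in> leaves T"
proof (induction T)
  case (PTree ts)
  show ?case
  proof (cases ts)
    case Nil
    then show ?thesis
      by (intro exI[of _ 0]) (simp add: leaves_def outdegree_def)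
  next
    case (Cons t ts')
    with PTree obtain j where j: "j < length (code t)" "\<forall>i<j. code t ! i \<noteq> 0"
        "replicate j 0 \<in> leaves t"
      by (metis list.set_intros(1))
    have "replicate (Suc j) 0 \<in> leaves (PTree ts)"
      using j(3) Cons by (simp add: leaves_def outdegree_def vertices_def)
    moreover have "code (PTree ts) ! i \<noteq> 0" if "i < Suc j" for i
      using that j Cons by (cases i) (auto simp: nth_append)
    ultimately show ?thesis
      using j(1) Cons by (intro exI[of _ "Suc j"]) auto
  qed
qed

lemma vertices_snocD: "v @ [i] \<in> vertices T \<Longrightarrow> v \<in> vertices T"
  unfolding vertices_def mem_Collect_eq
  by (induction v arbitrary: T) (metis is_vertex.simps(1) plane_tree.exhaust,
      metis append_Cons is_vertex.simps(2) plane_tree.exhaust)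

lemma graph_dist_root_le:
  assumes "v \<in> vertices T"
  shows "graph_dist T [] v \<le> length v"
proof -
  have "([], v) \<in> edges T ^^ length v"
    using assms
  proof (induction v rule: rev_induct)
    case (snoc i v)
    then have "v \<in> vertices T" by (blast dest: vertices_snocD)
    with snoc show ?case by (auto simp: edges_def)
  qed simp
  then show ?thesis unfolding graph_dist_def by (rule Least_le)
qed

text \<open>The leftmost leaf, at depth j, bounds the protection number by j. A large protection
  number thus forces a long zero-free prefix of the code.\<close>

lemma protection_number_code:
  assumes "k \<le> protection_number T v"
  shows "k < length (code (fringe_subtree T v)) \<and> (\<forall>i<k. code (fringe_subtree T v) ! i \<noteq> 0)"
proof -
  let ?F = "fringe_subtree T v"
  obtain j where j: "j < length (code ?F)" "\<forall>i<j. code ?F ! i \<noteq> 0" "replicate j 0 \<in> leaves ?F"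
    using leftmost_leaf by blast
  have "finite (leaves ?F)" by (simp add: leaves_def)
  then have "protection_number T v \<le> graph_dist ?F [] (replicate j 0)"
    unfolding protection_number_def using j(3) by (intro Min_le) auto
  also have "\<dots> \<le> j"
    using graph_dist_root_le[of "replicate j 0" ?F] j(3) by (simp add: leaves_def)
  finally show ?thesis using assms j by auto
qed

section \<open>The cycle lemma\<close>

lemma excess_concat_code:
  "(\<And>t. t \<in> set ts \<Longrightarrow> excess (code t) = -1) \<Longrightarrow> excess (concat (map code ts)) = - int (length ts)"
  by (induction ts) auto

lemma excess_code [simp]: "excess (code T) = -1"
  by (induction T) (simp add: excess_concat_code)

text \<open>Codes are prefix-free: the root entry fixes how many subtrees follow, and these are
  split off one by one. The remainders let the induction hypothesis apply to a child followed by its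
  siblings.\<close>

lemma code_append_eq: "code T @ r = code T' @ r' \<Longrightarrow> T = T' \<and> r = r'"
proof (induction T arbitrary: T' r r')
  case (PTree ts)
  obtain ts' where T': "T' = PTree ts'" by (cases T')
  have "length ts = length ts' \<Longrightarrow> concat (map code ts) @ r = concat (map code ts') @ r' \<Longrightarrow>
      ts = ts' \<and> r = r'"
    using PTree.IH
  proof (induction ts arbitrary: ts')
    case (Cons t ts)
    obtain u us where ts': "ts' = u # us" using Cons.prems(1) by (cases ts') auto
    have "t = u \<and> concat (map code ts) @ r = concat (map code us) @ r'"
      using Cons.prems(2) ts' by (intro Cons.prems(3)) auto
    then show ?case using Cons.IH[of us] Cons.prems ts' by auto
  qed simp
  with PTree.prems T' show ?case by simp
qed

text \<open>With m > 0 trees still to be read, an entry d is the root of one of them and demands d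
  children, leaving d + m - 1; the bound on the excess passes to the tail.\<close>

lemma parse_forest:
  "excess s \<le> - int m \<Longrightarrow> \<exists>ts r. length ts = m \<and> s = concat (map code ts) @ r"
proof (induction s arbitrary: m)
  case (Cons d s)
  show ?case
  proof (cases m)
    case (Suc m')
    obtain ts r where ts: "length ts = d + m'" "s = concat (map code ts) @ r"
      using Cons.IH[of "d + m'"] Cons.prems Suc by auto
    \<comment> \<open>The first d trees parsed from the tail become the children of the new
      root.\<close>
    have "concat (map code ts) = concat (map code (take d ts)) @ concat (map code (drop d ts))"
      by (metis append_take_drop_id concat_append map_append)
    then have "d # s = concat (map code (PTree (take d ts) # drop d ts)) @ r"
      using ts by simp
    then show ?thesis using ts Suc
      by (intro exI[of _ "PTree (take d ts) # drop d ts"] exI[of _ r]) auto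
  qed simp
qed simp

lemma parse_tree:
  assumes "excess s < 0"
  obtains T r where "s = code T @ r"
proof -
  obtain ts r where "length ts = 1" "s = concat (map code ts) @ r"
    using parse_forest[of s 1] assms by auto
  then show ?thesis using that by (cases ts) auto
qed

text \<open>A prefix of negative excess would already contain a complete code, contradicting unique
  parsing. So the walk of a tree stays non-negative until its last step.\<close>

lemma excess_prefix_code:
  assumes "code T = a @ b" "b \<noteq> []"
  shows "excess a \<ge> 0"
proof (rule ccontr)
  assume "\<not> excess a \<ge> 0"
  then obtain T' r where "a = code T' @ r" by (meson not_le parse_tree)
  then have "code T @ [] = code T' @ (r @ b)" using assms by simp
  from code_append_eq[OF this] assms(2) show False by simp
qed

text \<open>Writing \<open>sum_list s + 1 = n\<close> avoids truncated subtraction and makes the set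
  empty for n = 0.\<close>

definition degree_sequences :: "nat \<Rightarrow> nat list set" where
  "degree_sequences n = {s. length s = n \<and> sum_list s + 1 = n}"

lemma excess_degree_sequence: "s \<in> degree_sequences n \<longleftrightarrow> length s = n \<and> excess s = -1"
  by (auto simp: degree_sequences_def excess_eq)

lemma zero_in_degree_sequence:
  assumes "s \<in> degree_sequences n"
  shows "0 \<in> set s"
proof (rule ccontr)
  assume "0 \<notin> set s"
  then have "length s \<le> sum_list s" by (induction s) auto
  with assms show False by (simp add: degree_sequences_def)
qed

lemma finite_degree_sequences [simp]: "finite (degree_sequences n)"
proof (rule finite_subset)
  show "degree_sequences n \<subseteq> {s. set s \<subseteq> {..n} \<and> length s \<le> n}"
    using member_le_sum_list by (fastforce simp: degree_sequences_def)
qed (simp add: finite_lists_length_le)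

text \<open>The rotation starts at the first minimum of the partial sums of the excess.\<close>

lemma rotate_to_code:
  assumes "excess s = -1"
  obtains i T where "i \<le> length s" "rotate i s = code T"
proof -
  define n where "n = length s"
  define S where "S = (\<lambda>i. excess (take i s))"
  define i where "i = (LEAST i. i \<le> n \<and> S i = Min (S ` {..n}))"
  have "\<exists>i. i \<le> n \<and> S i = Min (S ` {..n})"
    using Min_in[of "S ` {..n}"] by fastforce
  then have i: "i \<le> n" "S i = Min (S ` {..n})"
    unfolding i_def by (metis (mono_tags, lifting) LeastI_ex)+
  have le: "S i \<le> S l" if "l \<le> n" for l
    using that unfolding i(2) by (intro Min_le) auto
  \<comment> \<open>Choosing the first minimum gives strict inequality to its left, which the
    wrap-around case below uses.\<close>
  have less: "S i < S l" if "l < i" for l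
    using not_less_Least[OF that[unfolded i_def]] le[of l] i that by (simp add: order.strict_iff_order)
  have rot: "rotate i s = drop i s @ take i s"
    using i(1) by (cases "i = n") (auto simp: n_def rotate_drop_take)
  have drop: "excess (drop i s) = - 1 - S i"
  proof -
    have "excess (take i s) + excess (drop i s) = -1"
      by (metis append_take_drop_id assms excess_simps(3))
    then show ?thesis by (simp add: S_def)
  qed
  have "excess (rotate i s) < 0"
    using drop rot by (simp add: S_def)
  then obtain T r where T: "rotate i s = code T @ r" by (rule parse_tree)
  have "r = []"
  proof (rule ccontr)
    assume "r \<noteq> []"
    define l where "l = length (code T)"
    have "n = l + length r"
      using arg_cong[OF T, of length] by (simp add: l_def n_def)
    moreover have "length r > 0" using \<open>r \<noteq> []\<close> by simp
    ultimately have l: "l < n" "code T = take l (rotate i s)"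
      by (linarith, simp add: T l_def)
    \<comment> \<open>Without wrap-around the excess is a partial sum minus the minimum
      \<open>S i\<close>. With wrap-around an extra -1 appears, compensated by the strict inequality
      between integers.\<close>
    have "excess (code T) \<ge> 0"
    proof (cases "l \<le> n - i")
      case True
      then have "code T = take l (drop i s)" using l rot by (simp add: n_def)
      moreover have "S (i + l) = S i + excess (take l (drop i s))"
        by (simp add: S_def take_add)
      ultimately show ?thesis using le[of "i + l"] True i by simp
    next
      case False
      have lt: "l - (n - i) < i" using l i False by linarith
      then have "code T = drop i s @ take (l - (n - i)) s"
        using l(2) rot False by (simp only: take_append) (simp add: n_def min_absorb1)
      then have "excess (code T) = - 1 - S i + S (l - (n - i))"
        using drop by (simp add: S_def)
      then show ?thesis using less[OF lt] by linarith
    qed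
    then show False by simp
  qed
  with T i(1) show ?thesis using that by (auto simp: n_def)
qed

lemma mset_rotate [simp]: "mset (rotate i s) = mset s"
  by (metis add.commute append_take_drop_id mset_append rotate_drop_take)

text \<open>If one code is a nontrivial rotation of another, they split as a followed by b and b
  followed by a. Both a and b are then proper prefixes of codes, so their excesses are non-negative
  and cannot add up to -1.\<close>

lemma rotate_code_inj:
  assumes T: "tree_order T = tree_order T'"
    and ij: "i < tree_order T'" "j < tree_order T'"
    and eq: "rotate i (code T) = rotate j (code T')"
  shows "T = T' \<and> i = j"
proof -
  let ?n = "tree_order T'"
  \<comment> \<open>Rotating by \<open>?n - j\<close> undoes the rotation by j, so m is the net
    rotation from \<open>code T\<close> to \<open>code T'\<close>.\<close>
  define m where "m = (?n - j + i) mod ?n"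
  have "code T' = rotate (?n - j) (rotate j (code T'))"
    using ij by (simp add: rotate_rotate flip: length_code)
  also have "\<dots> = rotate (?n - j + i) (code T)"
    by (simp add: rotate_rotate flip: eq)
  also have "\<dots> = rotate m (code T)"
    by (metis m_def T length_code rotate_conv_mod)
  finally have rot: "code T' = rotate m (code T)" .
  have m: "m < ?n" using ij by (simp add: m_def)
  then have split: "code T = take m (code T) @ drop m (code T)"
      "code T' = drop m (code T) @ take m (code T)"
    using rot T by (simp_all add: rotate_drop_take length_code)
  have "m = 0"
  proof (rule ccontr)
    assume "m \<noteq> 0"
    then have "excess (take m (code T)) \<ge> 0" "excess (drop m (code T)) \<ge> 0"
      using excess_prefix_code[OF split(1)] excess_prefix_code[OF split(2)] m T
      by (auto simp: length_code)
    then have "excess (code T) \<ge> 0" by (metis add_nonneg_nonneg excess_simps(3) split(1))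
    then show False by simp
  qed
  then have "code T @ [] = code T' @ []" using rot by simp
  then have "T = T'" using code_append_eq by blast
  moreover have "i = j"
  proof (cases "i < j")
    case True
    then have "m = ?n - j + i" unfolding m_def using ij by (intro mod_less) auto
    with \<open>m = 0\<close> ij show ?thesis by simp
  next
    case False
    have "m = (?n + (i - j)) mod ?n"
      unfolding m_def using False ij by (intro arg_cong2[of _ _ _ _ "(mod)"]) auto
    also have "\<dots> = i - j" using ij by simp
    finally have "m = i - j" .
    with \<open>m = 0\<close> False show ?thesis by simp
  qed
  ultimately show ?thesis by simp
qed

text \<open>The cycle lemma in bijective form. Rotation preserves length and sum; surjectivity
  undoes the rotation found by \<open>rotate_to_code\<close>.\<close>

lemma bij_betw_rotate_code:
  "bij_betw (\<lambda>(T, i). rotate i (code T)) ({T. tree_order T = n} \<times> {..<n}) (degree_sequences n)"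
proof (rule bij_betw_imageI)
  show "inj_on (\<lambda>(T, i). rotate i (code T)) ({T. tree_order T = n} \<times> {..<n})"
    using rotate_code_inj by (fastforce intro!: inj_onI)
  show "(\<lambda>(T, i). rotate i (code T)) ` ({T. tree_order T = n} \<times> {..<n}) = degree_sequences n"
  proof (intro equalityI subsetI)
    fix s assume "s \<in> (\<lambda>(T, i). rotate i (code T)) ` ({T. tree_order T = n} \<times> {..<n})"
    then obtain T i where T: "tree_order T = n" "s = rotate i (code T)" by auto
    have "sum_list (rotate i (code T)) = sum_list (code T)"
      by (metis mset_rotate sum_mset_sum_list)
    then have "excess s = excess (code T)"
      using T by (simp add: excess_eq)
    then show "s \<in> degree_sequences n"
      using T by (simp add: excess_degree_sequence length_code)
  next
    fix s assume "s \<in> degree_sequences n"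
    then have s: "length s = n" "excess s = -1" by (simp_all add: excess_degree_sequence)
    then have "n > 0" by (cases s) auto
    from s(2) obtain i T where i: "i \<le> length s" "rotate i s = code T" by (rule rotate_to_code)
    have n: "tree_order T = n" using i s by (metis length_code length_rotate)
    have "s = rotate (n - i) (code T)"
      using i s by (simp add: rotate_rotate flip: i(2))
    \<comment> \<open>The case i = 0 gives n - i = n, outside the index range, hence the reduction
      modulo n.\<close>
    also have "\<dots> = rotate ((n - i) mod n) (code T)"
      by (metis n length_code rotate_conv_mod)
    finally show "s \<in> (\<lambda>(T, i). rotate i (code T)) ` ({T. tree_order T = n} \<times> {..<n})"
      using n \<open>n > 0\<close> by (intro image_eqI[of _ _ "(T, (n - i) mod n)"]) auto
  qed
qed

section \<open>Exchangeability\<close>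

definition seq_weight :: "(nat \<Rightarrow> real) \<Rightarrow> nat list \<Rightarrow> real" where
  "seq_weight w s = (\<Prod>x\<leftarrow>s. w x)"

lemma seq_weight_mset: "mset s = mset t \<Longrightarrow> seq_weight w s = seq_weight w t"
  unfolding seq_weight_def by (metis mset_map prod_mset_prod_list)

lemma seq_weight_append: "seq_weight w (s @ t) = seq_weight w s * seq_weight w t"
  by (simp add: seq_weight_def)

lemma seq_weight_nonneg: "(\<And>k. w k \<ge> 0) \<Longrightarrow> seq_weight w s \<ge> 0"
  unfolding seq_weight_def by (rule prod_list_nonneg) auto

definition permutation_closed :: "'a list set \<Rightarrow> bool" where
  "permutation_closed A \<longleftrightarrow> (\<forall>s t. s \<in> A \<longrightarrow> mset t = mset s \<longrightarrow> t \<in> A)"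

lemma count_list_drop:
  "count_list (drop k s) d = card {j. k \<le> j \<and> j < length s \<and> s ! j = d}"
proof -
  have "count_list (drop k s) d = card {i. i < length s - k \<and> s ! (k + i) = d}"
    by (auto simp: count_list_eq_length_filter length_filter_conv_card intro!: arg_cong[of _ _ card])
  also have "\<dots> = card ((+) k ` {i. i < length s - k \<and> s ! (k + i) = d})"
    by (simp add: card_image)
  also have "(+) k ` {i. i < length s - k \<and> s ! (k + i) = d}
      = {j. k \<le> j \<and> j < length s \<and> s ! j = d}"
  proof (intro equalityI subsetI)
    fix j assume "j \<in> {j. k \<le> j \<and> j < length s \<and> s ! j = d}"
    then show "j \<in> (+) k ` {i. i < length s - k \<and> s ! (k + i) = d}"
      by (intro image_eqI[of _ _ "j - k"]) auto
  qed auto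
  finally show ?thesis .
qed

text \<open>Double counting of the positions from k on that carry d: exchanging positions k and j
  preserves \<open>f\<close> and the first k entries, so all n - k positions contribute
  equally.\<close>

lemma sum_exchangeable:
  fixes f :: "'a list \<Rightarrow> real"
  assumes fin: "finite A" and len: "\<And>s. s \<in> A \<Longrightarrow> length s = n"
    and closed: "permutation_closed A"
    and f: "\<And>s t. mset s = mset t \<Longrightarrow> f s = f t" and "k < n"
  shows "(\<Sum>s | s \<in> A \<and> P (take k s) \<and> s ! k = d. f s) * real (n - k)
       = (\<Sum>s | s \<in> A \<and> P (take k s). f s * real (count_list (drop k s) d))"
proof -
  define B where "B = {s \<in> A. P (take k s)}"
  have finB: "finite B" using fin by (simp add: B_def)
  have swap: "(\<Sum>s | s \<in> B \<and> s ! j = d. f s) = (\<Sum>s | s \<in> B \<and> s ! k = d. f s)"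
    if j: "k \<le> j" "j < n" for j
  proof -
    define \<sigma> where "\<sigma> = (\<lambda>s::'a list. s[k := s ! j, j := s ! k])"
    have m: "mset (\<sigma> s) = mset s" if "length s = n" for s
      using j that unfolding \<sigma>_def by (subst mset_swap) auto
    have inv: "\<sigma> (\<sigma> s) = s" if "length s = n" for s
      using j that unfolding \<sigma>_def
      by (intro nth_equalityI) (auto simp: nth_list_update)
    have memB: "\<sigma> s \<in> B" if "s \<in> B" for s
    proof -
      have "length s = n" "s \<in> A" using that len by (auto simp: B_def)
      then have "\<sigma> s \<in> A" using closed m unfolding permutation_closed_def by blast
      moreover have "take k (\<sigma> s) = take k s" using j by (simp add: \<sigma>_def)
      ultimately show ?thesis using that by (simp add: B_def)
    qed
    have lenB: "length s = n" if "s \<in> B" for s using that len by (auto simp: B_def)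
    have \<sigma>_nth: "\<sigma> s ! k = s ! j" "\<sigma> s ! j = s ! k" if "s \<in> B" for s
      using j lenB[OF that] by (auto simp: \<sigma>_def nth_list_update)
    show ?thesis
      by (rule sum.reindex_bij_witness[of _ \<sigma> \<sigma>])
        (use inv lenB memB \<sigma>_nth f[OF m] in auto)
  qed
  have "(\<Sum>s\<in>B. f s * real (count_list (drop k s) d))
      = (\<Sum>s\<in>B. \<Sum>j=k..<n. if s ! j = d then f s else 0)"
  proof (rule sum.cong)
    fix s assume "s \<in> B"
    then have "length s = n" using len by (auto simp: B_def)
    then have "{j. k \<le> j \<and> j < length s \<and> s ! j = d} = {k..<n} \<inter> {j. s ! j = d}" by auto
    then show "f s * real (count_list (drop k s) d) = (\<Sum>j=k..<n. if s ! j = d then f s else 0)"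
      by (simp add: count_list_drop sum.If_cases)
  qed simp
  also have "\<dots> = (\<Sum>j=k..<n. \<Sum>s\<in>B. if s ! j = d then f s else 0)"
    by (rule sum.swap)
  also have "\<dots> = (\<Sum>j=k..<n. \<Sum>s | s \<in> B \<and> s ! j = d. f s)"
    by (rule sum.cong) (simp_all add: sum.inter_filter finB)
  also have "\<dots> = (\<Sum>j=k..<n. \<Sum>s | s \<in> B \<and> s ! k = d. f s)"
    by (rule sum.cong, rule refl, rule swap) auto
  finally show ?thesis by (simp add: B_def conj_assoc mult.commute)
qed

text \<open>The condition on the number of zeros is kept abstract to cover both the lists with many
  zeros and those with few.\<close>

lemma permutation_closed_degree_sequences:
  "permutation_closed {s \<in> degree_sequences n. Q (count_list s 0)}"
  unfolding permutation_closed_def degree_sequences_def mem_Collect_eq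
proof (intro allI impI conjI; elim conjE)
  fix s t :: "nat list" assume eq: "mset t = mset s"
  have "count_list t 0 = count_list s 0" using eq by (metis count_mset)
  then show "Q (count_list s 0) \<Longrightarrow> Q (count_list t 0)" by simp
  show "length s = n \<Longrightarrow> length t = n" using eq by (metis size_mset)
  show "sum_list s + 1 = n \<Longrightarrow> sum_list t + 1 = n" using eq by (metis sum_mset_sum_list)
qed

text \<open>Reveal the entries one by one. If the first k are nonzero, all of the at least \<delta>
  n zeros lie among the other n - k positions, so the next entry is zero with conditional
  probability at least \<delta>; each entry costs a factor 1 - \<delta>.\<close>

lemma sum_nonzero_prefix_le:
  assumes w: "\<And>k. w k \<ge> 0" and "k \<le> n" "0 \<le> \<delta>" "\<delta> \<le> 1"
    and A: "A = {s \<in> degree_sequences n. \<delta> * real n \<le> real (count_list s 0)}"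
  shows "(\<Sum>s | s \<in> A \<and> 0 \<notin> set (take k s). seq_weight w s)
       \<le> (1 - \<delta>) ^ k * (\<Sum>s\<in>A. seq_weight w s)"
  using \<open>k \<le> n\<close>
proof (induction k)
  case (Suc k)
  let ?W = "seq_weight w"
  let ?P = "\<lambda>k s. 0 \<notin> set (take k s)"
  have finA: "finite A" using finite_degree_sequences[of n] by (simp add: A)
  have lenA: "length s = n" if "s \<in> A" for s using that by (simp add: A degree_sequences_def)
  define U where "U = (\<Sum>s | s \<in> A \<and> ?P k s. ?W s)"
  define V where "V = (\<Sum>s | s \<in> A \<and> ?P k s \<and> s ! k = 0. ?W s)"
  have U: "U \<ge> 0" and V: "V \<ge> 0"
    unfolding U_def V_def by (intro sum_nonneg seq_weight_nonneg w)+
  have "\<delta> * n * U = (\<Sum>s | s \<in> A \<and> ?P k s. ?W s * (\<delta> * n))"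
    by (simp add: U_def sum_distrib_left sum_distrib_right mult_ac)
  also have "\<dots> \<le> (\<Sum>s | s \<in> A \<and> ?P k s. ?W s * real (count_list (drop k s) 0))"
  proof (intro sum_mono mult_left_mono seq_weight_nonneg w)
    fix s assume "s \<in> {s. s \<in> A \<and> ?P k s}"
    then have "s \<in> A" "count_list (take k s) 0 = 0" by (auto simp: count_list_0_iff)
    moreover have "count_list s 0 = count_list (take k s) 0 + count_list (drop k s) 0"
      by (metis append_take_drop_id count_list_append)
    ultimately show "\<delta> * n \<le> real (count_list (drop k s) 0)" by (simp add: A)
  qed
  also have "\<dots> = V * real (n - k)"
    unfolding V_def
    by (rule sum_exchangeable[symmetric, OF finA lenA])
      (use Suc.prems permutation_closed_degree_sequences[of n "\<lambda>x. \<delta> * real n \<le> real x"]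
        in \<open>auto simp: A intro: seq_weight_mset\<close>)
  also have "\<dots> \<le> V * n" using V by (intro mult_left_mono) auto
  finally have "\<delta> * U \<le> V" using Suc.prems by (simp add: mult_ac)
  moreover have "U = (\<Sum>s | s \<in> A \<and> ?P (Suc k) s. ?W s) + V"
    unfolding U_def V_def
  proof (subst sum.union_disjoint[symmetric])
    have "take (Suc k) s = take k s @ [s ! k]" if "s \<in> A" for s
      using lenA[OF that] Suc.prems by (intro take_Suc_conv_app_nth) simp
    then have "{s. s \<in> A \<and> ?P k s}
        = {s. s \<in> A \<and> ?P (Suc k) s} \<union> {s. s \<in> A \<and> ?P k s \<and> s ! k = 0}"
      by auto
    then show "sum ?W {s. s \<in> A \<and> ?P k s}
        = sum ?W ({s. s \<in> A \<and> ?P (Suc k) s} \<union> {s. s \<in> A \<and> ?P k s \<and> s ! k = 0})" by simp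
    show "{s. s \<in> A \<and> ?P (Suc k) s} \<inter> {s. s \<in> A \<and> ?P k s \<and> s ! k = 0} = {}"
      using \<open>\<And>s. s \<in> A \<Longrightarrow> take (Suc k) s = take k s @ [s ! k]\<close> by force
  qed (use finA in auto)
  ultimately have "(\<Sum>s | s \<in> A \<and> ?P (Suc k) s. ?W s) \<le> (1 - \<delta>) * U"
    by (simp add: algebra_simps)
  also have "\<dots> \<le> (1 - \<delta>) * ((1 - \<delta>) ^ k * (\<Sum>s\<in>A. ?W s))"
    using Suc assms(4) by (intro mult_left_mono) (auto simp: U_def)
  finally show ?case by (simp add: mult.assoc)
qed simp

section \<open>Few leaves are unlikely\<close>

text \<open>Every entry x satisfies 2 \<le> x + [x = 1] + 2 [x = 0]; sum this over a list of length
  n and sum n - 1.\<close>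

lemma count_list_one_ge:
  assumes "s \<in> degree_sequences n"
  shows "n + 1 \<le> count_list s 1 + 2 * count_list s 0"
proof -
  have "2 * length s \<le> sum_list s + count_list s 1 + 2 * count_list s 0" for s :: "nat list"
    by (induction s) auto
  from this[of s] assms show ?thesis by (auto simp: degree_sequences_def)
qed

text \<open>A real threshold can be a fraction of n and be raised by L without rounding.\<close>

definition few_leaves :: "nat \<Rightarrow> real \<Rightarrow> nat list set" where
  "few_leaves n x = {s \<in> degree_sequences n. real (count_list s 0) < x}"

lemma finite_few_leaves [simp]: "finite (few_leaves n x)"
  using finite_degree_sequences[of n] by (simp add: few_leaves_def)

lemma length_few_leaves: "s \<in> few_leaves n x \<Longrightarrow> length s = n"
  by (simp add: few_leaves_def degree_sequences_def)

lemma permutation_closed_few_leaves: "permutation_closed (few_leaves n x)"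
  unfolding few_leaves_def by (rule permutation_closed_degree_sequences)

text \<open>With so few zeros, at least half of the entries not yet revealed are ones throughout the
  first K positions, so requiring one more 1 costs at most a factor 2.\<close>

lemma sum_prefix_ones_ge:
  assumes w: "\<And>k. w k \<ge> 0" and x: "x \<le> real n / 8" and "2 * K \<le> n"
  shows "(\<Sum>s | s \<in> few_leaves n x \<and> take K s = replicate K 1. seq_weight w s)
       \<ge> (1 / 2) ^ K * (\<Sum>s\<in>few_leaves n x. seq_weight w s)"
  using \<open>2 * K \<le> n\<close>
proof (induction K)
  case (Suc k)
  let ?A = "few_leaves n x" and ?W = "seq_weight w"
  let ?P = "\<lambda>k s. take k s = replicate k 1"
  define U where "U = (\<Sum>s | s \<in> ?A \<and> ?P k s. ?W s)"
  define V where "V = (\<Sum>s | s \<in> ?A \<and> ?P k s \<and> s ! k = 1. ?W s)"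
  have "U * (real (n - k) / 2) = (\<Sum>s | s \<in> ?A \<and> ?P k s. ?W s * (real (n - k) / 2))"
    by (simp add: U_def sum_distrib_right)
  also have "\<dots> \<le> (\<Sum>s | s \<in> ?A \<and> ?P k s. ?W s * real (count_list (drop k s) 1))"
  proof (intro sum_mono mult_left_mono seq_weight_nonneg w)
    fix s assume "s \<in> {s. s \<in> ?A \<and> ?P k s}"
    then have s: "s \<in> degree_sequences n" "real (count_list s 0) < x" "?P k s"
      by (auto simp: few_leaves_def)
    have "count_list s 1 = count_list (take k s) 1 + count_list (drop k s) 1"
      by (metis append_take_drop_id count_list_append)
    also have "count_list (take k s) 1 = k"
      unfolding s(3) by (induction k) auto
    finally have "n + 1 \<le> k + count_list (drop k s) 1 + 2 * count_list s 0"
      using count_list_one_ge[OF s(1)] by simp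
    \<comment> \<open>Since there are fewer than n/8 zeros and k \<le> n/2, the count of ones
      exceeds 3n/4 - k \<ge> (n - k)/2.\<close>
    then show "real (n - k) / 2 \<le> real (count_list (drop k s) 1)"
      using s(2) x Suc.prems by (simp add: of_nat_diff)
  qed
  also have "\<dots> = V * real (n - k)"
    unfolding V_def
    by (rule sum_exchangeable[symmetric]) (use Suc.prems permutation_closed_few_leaves
        in \<open>auto simp: length_few_leaves intro: seq_weight_mset\<close>)
  finally have "U / 2 * real (n - k) \<le> V * real (n - k)"
    by (simp only: times_divide_eq_right times_divide_eq_left)
  then have V: "U / 2 \<le> V"
    by (rule mult_right_le_imp_le) (use Suc.prems in simp)
  have eq: "{s. s \<in> ?A \<and> ?P k s \<and> s ! k = 1} = {s. s \<in> ?A \<and> ?P (Suc k) s}"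
  proof (rule Collect_cong, rule conj_cong)
    fix s assume "s \<in> ?A"
    then have "take (Suc k) s = take k s @ [s ! k]"
      using Suc.prems by (intro take_Suc_conv_app_nth) (simp add: length_few_leaves)
    moreover have "replicate (Suc k) (1::nat) = replicate k 1 @ [1]"
      by (simp add: replicate_append_same)
    ultimately show "(?P k s \<and> s ! k = 1) = ?P (Suc k) s"
      by (simp only: append1_eq_conv)
  qed simp
  have "(1 / 2) ^ k * (\<Sum>s\<in>?A. ?W s) \<le> U"
    unfolding U_def using Suc.prems by (intro Suc.IH) simp
  then have "(1 / 2) ^ Suc k * (\<Sum>s\<in>?A. ?W s) \<le> U / 2"
    by simp
  also note V
  also have "V = (\<Sum>s | s \<in> ?A \<and> ?P (Suc k) s. ?W s)"
    unfolding V_def eq ..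
  finally show ?case .
qed simp

text \<open>By exchangeability the first entry is zero with probability equal to the mean proportion
  of zeros.\<close>

lemma sum_head_zero_le:
  assumes w: "\<And>k. w k \<ge> 0" and x: "x \<le> \<delta> * real n" and "n > 0"
  shows "(\<Sum>s | s \<in> few_leaves n x \<and> s ! 0 = 0. seq_weight w s)
       \<le> \<delta> * (\<Sum>s\<in>few_leaves n x. seq_weight w s)"
proof -
  let ?A = "few_leaves n x" and ?W = "seq_weight w"
  have "(\<Sum>s | s \<in> ?A \<and> s ! 0 = 0. ?W s) * real n = (\<Sum>s\<in>?A. ?W s * real (count_list s 0))"
    using sum_exchangeable[where P = "\<lambda>_. True" and k = 0 and d = 0 and f = ?W, OF finite_few_leaves
        length_few_leaves permutation_closed_few_leaves seq_weight_mset \<open>n > 0\<close>]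
    by simp
  also have "\<dots> \<le> (\<Sum>s\<in>?A. ?W s * (\<delta> * real n))"
    using x by (intro sum_mono mult_left_mono seq_weight_nonneg w) (auto simp: few_leaves_def)
  also have "\<dots> = \<delta> * (\<Sum>s\<in>?A. ?W s) * real n"
    by (simp add: sum_distrib_left sum_distrib_right mult_ac)
  finally show ?thesis using \<open>n > 0\<close> by simp
qed

text \<open>Switching: a prefix of \<open>Suc L\<close> ones becomes \<open>L\<close> zeros followed by \<open>Suc L\<close>, which changes
  neither the length nor the sum.\<close>

lemma sum_few_leaves_switch:
  assumes w: "\<And>k. w k \<ge> 0" and "L > 0" and x: "x + real L \<le> \<delta> * real n"
    and \<delta>: "0 \<le> \<delta>" "\<delta> \<le> 1 / 8" "2 * w 1 ^ Suc L * \<delta> \<le> w 0 ^ L * w (Suc L) * (1 / 2) ^ Suc L"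
    and pos: "w 0 > 0" "w (Suc L) > 0" and n: "2 * Suc L \<le> n"
  shows "2 * (\<Sum>s\<in>few_leaves n x. seq_weight w s) \<le> (\<Sum>s\<in>few_leaves n (x + real L). seq_weight w s)"
proof -
  let ?W = "seq_weight w"
  define K where "K = Suc L"
  define q where "q = replicate L 0 @ [K]"
  define D where "D = {s. s \<in> few_leaves n x \<and> take K s = replicate K 1}"
  \<comment> \<open>Since L > 0, switched lists begin with a zero. This confines them to a
    \<delta>-fraction of the target weight, which is the source of the gain.\<close>
  define E where "E = {s. s \<in> few_leaves n (x + real L) \<and> s ! 0 = 0}"
  define G where "G = (\<lambda>x. \<Sum>s\<in>few_leaves n x. ?W s)"
  define \<sigma> where "\<sigma> = (\<lambda>s. q @ drop K s)"
  define \<rho> where "\<rho> = w 0 ^ L * w K"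
  have q: "length q = K" "sum_list q = K" "count_list q 0 = L" "seq_weight w q = \<rho>" "q ! 0 = 0"
    using \<open>L > 0\<close> by (auto simp: q_def K_def sum_list_replicate seq_weight_def \<rho>_def nth_append
        count_list_eq_length_filter)
  have D: "s = replicate K 1 @ drop K s" if "s \<in> D" for s
    using that append_take_drop_id[of K s] by (simp add: D_def)
  \<comment> \<open>Stated as a product rather than a quotient, so that \<open>w 1 = 0\<close> is
    covered.\<close>
  have W: "\<rho> * ?W s = w 1 ^ K * ?W (\<sigma> s)" if "s \<in> D" for s
    by (subst D[OF that]) (simp add: \<sigma>_def seq_weight_append q(4), simp add: seq_weight_def)
  have inj: "inj_on \<sigma> D"
    by (rule inj_onI) (metis D \<sigma>_def same_append_eq)
  have sub: "\<sigma> ` D \<subseteq> E"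
  proof (rule image_subsetI)
    fix s assume s: "s \<in> D"
    then have "s \<in> few_leaves n x" by (simp add: D_def)
    moreover have "count_list (replicate K (1::nat)) 0 = 0"
      by (simp add: count_list_0_iff)
    moreover have "length (\<sigma> s) = length s" "sum_list (\<sigma> s) = sum_list s"
      "count_list (\<sigma> s) 0 = L + count_list (drop K s) 0"
      using arg_cong[OF D[OF s], of length] arg_cong[OF D[OF s], of sum_list]
      by (simp_all add: \<sigma>_def q sum_list_replicate)
    moreover have "count_list s 0 = count_list (drop K s) 0"
      by (subst D[OF s]) (use calculation in simp)
    moreover have "\<sigma> s ! 0 = 0" using q by (simp add: \<sigma>_def nth_append K_def)
    ultimately show "\<sigma> s \<in> E"
      by (simp add: E_def few_leaves_def degree_sequences_def)
  qed
  have "x \<le> real n / 8"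
    using x \<delta> mult_right_mono[OF \<delta>(2), of "real n"] by simp
  then have 1: "(1 / 2) ^ K * G x \<le> (\<Sum>s\<in>D. ?W s)"
    unfolding D_def G_def using n by (intro sum_prefix_ones_ge w) (auto simp: K_def)
  have "\<rho> * ((1 / 2) ^ K * G x) \<le> \<rho> * (\<Sum>s\<in>D. ?W s)"
    using 1 pos by (intro mult_left_mono) (auto simp: \<rho>_def K_def)
  also have "\<dots> = w 1 ^ K * (\<Sum>s\<in>\<sigma> ` D. ?W s)"
    by (simp add: sum.reindex[OF inj] sum_distrib_left W)
  also have "\<dots> \<le> w 1 ^ K * (\<Sum>s\<in>E. ?W s)"
    using sub w by (intro mult_left_mono sum_mono2 seq_weight_nonneg zero_le_power)
      (auto simp: E_def)
  also have "\<dots> \<le> w 1 ^ K * (\<delta> * G (x + real L))"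
    unfolding E_def G_def using n by (intro mult_left_mono sum_head_zero_le w x zero_le_power) auto
  finally have "2 * (\<rho> * (1 / 2) ^ K * G x) \<le> 2 * w 1 ^ K * \<delta> * G (x + real L)"
    by simp
  \<comment> \<open>The smallness condition on \<delta> absorbs both the weight ratio and the factor
    2 ^ K lost in fixing the prefix of ones.\<close>
  also have "\<dots> \<le> \<rho> * (1 / 2) ^ K * G (x + real L)"
    using \<delta>(3) unfolding \<rho>_def K_def G_def
    by (intro mult_right_mono sum_nonneg seq_weight_nonneg w)
  finally have "\<rho> * (1 / 2) ^ K * (2 * G x) \<le> \<rho> * (1 / 2) ^ K * G (x + real L)"
    by (simp add: mult_ac)
  moreover have "\<rho> * (1 / 2) ^ K > 0" using pos by (simp add: \<rho>_def K_def)
  ultimately show ?thesis unfolding G_def by (metis mult_le_cancel_left_pos)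
qed

text \<open>Each switch raises the threshold by L and at least doubles the total weight; j switches
  are possible while the threshold stays below \<delta> n.\<close>

lemma sum_few_leaves_iterate:
  assumes w: "\<And>k. w k \<ge> 0" and "L > 0" and x: "x + real j * real L \<le> \<delta> * real n"
    and \<delta>: "0 \<le> \<delta>" "\<delta> \<le> 1 / 8" "2 * w 1 ^ Suc L * \<delta> \<le> w 0 ^ L * w (Suc L) * (1 / 2) ^ Suc L"
    and pos: "w 0 > 0" "w (Suc L) > 0" and n: "2 * Suc L \<le> n"
  shows "2 ^ j * (\<Sum>s\<in>few_leaves n x. seq_weight w s) \<le> (\<Sum>s\<in>degree_sequences n. seq_weight w s)"
  using x
proof (induction j arbitrary: x)
  case 0
  show ?case by (auto simp: few_leaves_def intro!: sum_mono2 seq_weight_nonneg w)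
next
  case (Suc j)
  have "x + real L + real j * real L \<le> \<delta> * real n"
    using Suc.prems by (simp add: algebra_simps)
  note IH = Suc.IH[OF this]
  have "0 \<le> real j * real L" by simp
  then have "x + real L \<le> \<delta> * real n"
    using \<open>x + real L + real j * real L \<le> \<delta> * real n\<close> by linarith
  from sum_few_leaves_switch[OF w \<open>L > 0\<close> this \<delta> pos n]
  have "2 ^ j * (2 * (\<Sum>s\<in>few_leaves n x. seq_weight w s))
      \<le> 2 ^ j * (\<Sum>s\<in>few_leaves n (x + real L). seq_weight w s)"
    by (rule mult_left_mono) simp
  also note IH
  finally show ?case by (simp add: mult_ac)
qed

text \<open>Starting at half of \<delta> n leaves room for about \<delta> n / (2 L) doublings.
  Rounding their number down costs the leading factor 2.\<close>

lemma sum_few_leaves_le: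
  assumes w: "\<And>k. w k \<ge> 0" and "L > 0"
    and \<delta>: "0 \<le> \<delta>" "\<delta> \<le> 1 / 8" "2 * w 1 ^ Suc L * \<delta> \<le> w 0 ^ L * w (Suc L) * (1 / 2) ^ Suc L"
    and pos: "w 0 > 0" "w (Suc L) > 0" and n: "2 * Suc L \<le> n"
  shows "(\<Sum>s\<in>few_leaves n (\<delta> / 2 * real n). seq_weight w s)
       \<le> 2 * exp (- (\<delta> * ln 2 / (2 * real L)) * real n) * (\<Sum>s\<in>degree_sequences n. seq_weight w s)"
proof -
  let ?F = "\<Sum>s\<in>few_leaves n (\<delta> / 2 * real n). seq_weight w s"
  let ?T = "\<Sum>s\<in>degree_sequences n. seq_weight w s"
  define y where "y = \<delta> * real n / (2 * real L)"
  define j where "j = nat \<lfloor>y\<rfloor>"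
  have y: "y \<ge> 0" using \<delta> by (simp add: y_def)
  then have j: "real j \<le> y" "y \<le> real j + 1" unfolding j_def by linarith+
  have "real j * real L \<le> y * real L" using j by (intro mult_right_mono) auto
  also have "\<dots> = \<delta> / 2 * real n" using \<open>L > 0\<close> by (simp add: y_def)
  finally have "2 ^ j * ?F \<le> ?T"
    by (intro sum_few_leaves_iterate[OF w \<open>L > 0\<close> _ \<delta> pos n]) simp
  moreover have "exp (y * ln 2) \<le> 2 * 2 ^ j"
  proof -
    have "exp (y * ln 2) \<le> exp (real (Suc j) * ln (2::real))"
      using j by simp
    also have "\<dots> = 2 ^ Suc j" by (subst exp_of_nat_mult) simp
    finally show ?thesis by simp
  qed
  moreover have "?F \<ge> 0" by (intro sum_nonneg seq_weight_nonneg w)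
  then have "exp (y * ln 2) * ?F \<le> 2 * 2 ^ j * ?F"
    using \<open>exp (y * ln 2) \<le> 2 * 2 ^ j\<close> by (intro mult_right_mono)
  ultimately have "exp (y * ln 2) * ?F \<le> 2 * ?T" by simp
  then have "?F \<le> 2 * exp (- (y * ln 2)) * ?T"
    by (simp add: exp_minus field_simps)
  then show ?thesis by (simp add: y_def mult_ac)
qed

text \<open>Split at \<delta> n / 2 zeros. Above it, exchangeability gives decay in k; below it, the
  weight decays in n, hence also in k as k \<le> n. The constant is 3 = 1 + 2.\<close>

lemma sum_nonzero_prefix_exp_bound:
  assumes w: "\<And>k. w k \<ge> 0" and "L > 0" and "k \<le> n"
    and \<delta>: "0 \<le> \<delta>" "\<delta> \<le> 1 / 8" "2 * w 1 ^ Suc L * \<delta> \<le> w 0 ^ L * w (Suc L) * (1 / 2) ^ Suc L"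
    and pos: "w 0 > 0" "w (Suc L) > 0" and n: "2 * Suc L \<le> n"
  shows "(\<Sum>s | s \<in> degree_sequences n \<and> 0 \<notin> set (take k s). seq_weight w s)
       \<le> 3 * exp (- (\<delta> * ln 2 / (2 * real L)) * real k) * (\<Sum>s\<in>degree_sequences n. seq_weight w s)"
proof -
  let ?W = "seq_weight w"
  define A where "A = {s \<in> degree_sequences n. \<delta> / 2 * real n \<le> real (count_list s 0)}"
  define F where "F = few_leaves n (\<delta> / 2 * real n)"
  define T where "T = (\<Sum>s\<in>degree_sequences n. ?W s)"
  define c where "c = \<delta> * ln 2 / (2 * real L)"
  have T: "T \<ge> 0" unfolding T_def by (intro sum_nonneg seq_weight_nonneg w)
  have finA: "finite A" using finite_degree_sequences[of n] by (simp add: A_def)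
  \<comment> \<open>This lets one rate serve both halves: 1 - \<delta>/2 \<le> 1 - c \<le> exp (-
    c).\<close>
  have c: "0 \<le> c" "c \<le> \<delta> / 2"
  proof -
    show "0 \<le> c" using \<delta> by (simp add: c_def)
    have "ln (2::real) \<le> 1" using ln_le_minus_one[of "2::real"] by simp
    then have "\<delta> * ln 2 \<le> \<delta> * real L"
      using \<delta> \<open>L > 0\<close> by (intro mult_left_mono) auto
    then show "c \<le> \<delta> / 2" using \<open>L > 0\<close> by (simp add: c_def field_simps)
  qed
  have "(\<Sum>s | s \<in> degree_sequences n \<and> 0 \<notin> set (take k s). ?W s)
      \<le> (\<Sum>s\<in>{s. s \<in> A \<and> 0 \<notin> set (take k s)} \<union> F. ?W s)"
    using finA by (intro sum_mono2 seq_weight_nonneg w) (auto simp: A_def F_def few_leaves_def)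
  also have "\<dots> \<le> (\<Sum>s | s \<in> A \<and> 0 \<notin> set (take k s). ?W s) + (\<Sum>s\<in>F. ?W s)"
    using finA by (subst sum.union_inter[symmetric])
      (auto simp: F_def intro!: sum_nonneg seq_weight_nonneg w)
  also have "\<dots> \<le> exp (- c * real k) * T + 2 * exp (- c * real k) * T"
  proof (rule add_mono)
    have "(\<Sum>s | s \<in> A \<and> 0 \<notin> set (take k s). ?W s) \<le> (1 - \<delta> / 2) ^ k * (\<Sum>s\<in>A. ?W s)"
      using \<delta> \<open>k \<le> n\<close> by (intro sum_nonzero_prefix_le w) (auto simp: A_def)
    also have "\<dots> \<le> exp (- c * real k) * T"
    proof (intro mult_mono)
      have "1 - \<delta> / 2 \<le> exp (- c)"
        using exp_ge_add_one_self[of "- c"] c by simp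
      then have "(1 - \<delta> / 2) ^ k \<le> exp (- c) ^ k"
        using \<delta> by (intro power_mono) auto
      then show "(1 - \<delta> / 2) ^ k \<le> exp (- c * real k)"
        by (simp add: exp_of_nat_mult[symmetric] mult_ac)
      show "(\<Sum>s\<in>A. ?W s) \<le> T"
        unfolding T_def by (intro sum_mono2 seq_weight_nonneg w) (auto simp: A_def)
    qed (auto intro!: sum_nonneg seq_weight_nonneg w)
    finally show "(\<Sum>s | s \<in> A \<and> 0 \<notin> set (take k s). ?W s) \<le> exp (- c * real k) * T" .
    have "(\<Sum>s\<in>F. ?W s) \<le> 2 * exp (- c * real n) * T"
      using sum_few_leaves_le[OF w \<open>L > 0\<close> \<delta> pos n] by (simp add: F_def T_def c_def)
    also have "\<dots> \<le> 2 * exp (- c * real k) * T"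
      using c \<open>k \<le> n\<close> T by (intro mult_right_mono) (auto intro: mult_left_mono)
    finally show "(\<Sum>s\<in>F. ?W s) \<le> 2 * exp (- c * real k) * T" .
  qed
  also have "\<dots> = 3 * exp (- c * real k) * T" by simp
  finally show ?thesis unfolding c_def T_def .
qed

section \<open>From rotated codes to random vertices\<close>

lemma sum_rotate_code:
  fixes f :: "nat list \<Rightarrow> real"
  shows "(\<Sum>T | tree_order T = n. \<Sum>i<n. f (rotate i (code T))) = (\<Sum>s\<in>degree_sequences n. f s)"
  using sum.reindex_bij_betw[OF bij_betw_rotate_code, of f n]
  by (simp add: sum.cartesian_product case_prod_unfold)

text \<open>The rotation by the preorder position of a vertex starts with the code of its fringe
  subtree, and that code is longer than k.\<close>

lemma card_protected_le:
  assumes "tree_order T = n"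
  shows "card {v \<in> vertices T. k \<le> protection_number T v}
       \<le> card {i. i < n \<and> 0 \<notin> set (take k (rotate i (code T)))}"
proof -
  define Q where "Q = (\<lambda>F. k < length (code F) \<and> (\<forall>i<k. code F ! i \<noteq> 0))"
  have "card {v \<in> vertices T. k \<le> protection_number T v}
      \<le> card {v \<in> vertices T. Q (fringe_subtree T v)}"
    using protection_number_code by (intro card_mono) (auto simp: Q_def)
  also have "\<dots> = card {i. i < n \<and> Q (fringe_list T ! i)}"
    using card_vertices_fringe_subtree assms by simp
  also have "\<dots> \<le> card {i. i < n \<and> 0 \<notin> set (take k (rotate i (code T)))}"
  proof (intro card_mono subsetI)
    fix i assume "i \<in> {i. i < n \<and> Q (fringe_list T ! i)}"
    then have i: "i < n" "Q (fringe_list T ! i)" by auto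
    then obtain r where r: "drop i (code T) = code (fringe_list T ! i) @ r"
      using drop_code assms by (metis length_fringe_list)
    have "rotate i (code T) = code (fringe_list T ! i) @ r @ take i (code T)"
      using i assms r by (simp add: rotate_drop_take length_code)
    then have "take k (rotate i (code T)) = take k (code (fringe_list T ! i))"
      using i by (simp add: Q_def)
    moreover have "0 \<notin> set (take k (code (fringe_list T ! i)))"
      using i by (auto simp: Q_def in_set_conv_nth)
    ultimately show "i \<in> {i. i < n \<and> 0 \<notin> set (take k (rotate i (code T)))}" using i by simp
  qed simp
  finally show ?thesis .
qed

text \<open>Given the tree, the probability is a proportion of vertices; averaging is a finite sum
  because only trees of order n have mass.\<close>

lemma prob_sgt_with_vertex:
  assumes "weight_sequence w" "sgt_defined w n"
  shows "measure_pmf.prob (sgt_with_vertex w n) {(T, v). Q T v}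
       = (\<Sum>T | tree_order T = n. tree_weight w T * real (card {v \<in> vertices T. Q T v}))
         / (real n * partition_function w n)"
proof -
  let ?p = "simply_generated_tree w n"
  have ne: "vertices T \<noteq> {}" for T using root_in_vertices by blast
  have inner: "measure_pmf.prob (map_pmf (Pair T) (pmf_of_set (vertices T))) {(T, v). Q T v}
      = real (card {v \<in> vertices T. Q T v}) / real (tree_order T)" for T
    using measure_pmf_of_set[OF ne finite_vertices, of T "{v. Q T v}"]
    by (simp add: tree_order_def Int_def vimage_def)
  have supp: "set_pmf ?p \<subseteq> {T. tree_order T = n}"
    using pmf_simply_generated_tree[OF assms] by (auto simp: set_pmf_iff split: if_splits)
  have "measure_pmf.prob (sgt_with_vertex w n) {(T, v). Q T v}
      = (\<integral>T. measure_pmf.prob (map_pmf (Pair T) (pmf_of_set (vertices T))) {(T, v). Q T v} \<partial>?p)"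
    unfolding sgt_with_vertex_def measure_pmf_bind
    by (subst measure_pmf.measure_bind[where N = "count_space UNIV"])
      (auto simp: space_subprob_algebra subprob_space_measure_pmf)
  also have "\<dots> = (\<integral>T. real (card {v \<in> vertices T. Q T v}) / real (tree_order T) \<partial>?p)"
    by (simp only: inner)
  also have "\<dots> = (\<Sum>T | tree_order T = n.
      real (card {v \<in> vertices T. Q T v}) / real (tree_order T) * pmf ?p T)"
    by (rule integral_measure_pmf_real) (use supp in auto)
  also have "\<dots> = (\<Sum>T | tree_order T = n.
      tree_weight w T * real (card {v \<in> vertices T. Q T v}) / (real n * partition_function w n))"
    by (rule sum.cong) (auto simp: pmf_simply_generated_tree[OF assms] mult_ac)
  finally show ?thesis by (simp add: sum_divide_distrib)
qed

lemma prob_protection_number_le: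
  assumes w: "weight_sequence w" and n: "sgt_defined w n"
  shows "measure_pmf.prob (sgt_with_vertex w n) {(T, v). k \<le> protection_number T v}
      \<le> (\<Sum>s | s \<in> degree_sequences n \<and> 0 \<notin> set (take k s). seq_weight w s)
         / (\<Sum>s\<in>degree_sequences n. seq_weight w s)"
proof -
  have W: "seq_weight w (rotate i (code T)) = tree_weight w T" for i T
    unfolding tree_weight_code seq_weight_def[symmetric] by (rule seq_weight_mset) simp
  \<comment> \<open>Each tree is counted once for each of its n rotations, all of the same
    weight.\<close>
  have total: "(\<Sum>s\<in>degree_sequences n. seq_weight w s) = real n * partition_function w n"
    by (simp add: W partition_function_def sum_distrib_left flip: sum_rotate_code)
  have "(\<Sum>T | tree_order T = n. tree_weight w T * real (card {v \<in> vertices T. k \<le> protection_number T v}))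
      \<le> (\<Sum>T | tree_order T = n. tree_weight w T
            * real (card {i. i < n \<and> 0 \<notin> set (take k (rotate i (code T)))}))"
    by (intro sum_mono mult_left_mono of_nat_mono card_protected_le tree_weight_nonneg w) simp
  also have "\<dots> = (\<Sum>T | tree_order T = n. \<Sum>i<n.
      if 0 \<notin> set (take k (rotate i (code T))) then seq_weight w (rotate i (code T)) else 0)"
    by (intro sum.cong) (simp_all add: W sum.If_cases Int_def mult.commute)
  also have "\<dots> = (\<Sum>s\<in>degree_sequences n. if 0 \<notin> set (take k s) then seq_weight w s else 0)"
    by (rule sum_rotate_code)
  also have "\<dots> = (\<Sum>s | s \<in> degree_sequences n \<and> 0 \<notin> set (take k s). seq_weight w s)"
    by (rule sum.inter_filter[symmetric]) simp
  finally show ?thesis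
    unfolding prob_sgt_with_vertex[OF w n] total
    using partition_function_pos[OF w n] by (intro divide_right_mono) auto
qed

theorem proposition5p3:
  fixes w :: "nat \<Rightarrow> real"
  assumes "weight_sequence w"
    and "type_I w \<or> type_II w \<or> type_III w"
  shows "\<exists>(n0::nat) (C::real) (c::real). n0 \<ge> 1 \<and> C > 0 \<and> c > 0 \<and>
    (\<forall>n\<ge>n0. sgt_defined w n \<longrightarrow>
      (\<forall>k::nat. measure_pmf.prob (sgt_with_vertex w n) {(T, v). protection_number T v \<ge> k}
                  \<le> C * exp (- c * real k)))"
proof -
  have w0: "w 0 > 0" and w: "w k \<ge> 0" for k
    using assms(1) by (auto simp: weight_sequence_def)
  obtain K where K: "K \<ge> 2" "w K > 0" using assms(1) by (auto simp: weight_sequence_def)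
  \<comment> \<open>Switching K ones into one entry K creates K - 1 zeros.\<close>
  define L where "L = K - 1"
  have L: "L > 0" "w (Suc L) > 0" using K by (auto simp: L_def)
  define \<rho> where "\<rho> = w 0 ^ L * w (Suc L) * (1 / 2) ^ Suc L"
  have \<rho>: "\<rho> > 0" using w0 L by (simp add: \<rho>_def)
  define u where "u = 2 * w 1 ^ Suc L"
  have u: "u \<ge> 0" unfolding u_def by (intro mult_nonneg_nonneg zero_le_power w) simp
  \<comment> \<open>The bound 1/8 serves the prefix of ones, the other one the gain in switching; u
    + 1 keeps the denominator positive when \<open>w 1 = 0\<close>.\<close>
  define \<delta> where "\<delta> = min (1 / 8) (\<rho> / (u + 1))"
  have \<delta>: "\<delta> > 0" "\<delta> \<le> 1 / 8" "\<delta> \<le> \<rho> / (u + 1)"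
    unfolding \<delta>_def using \<rho> u by (simp_all only: min.cobounded1 min.cobounded2) simp
  have "u * \<delta> \<le> (u + 1) * (\<rho> / (u + 1))"
    using \<delta> u by (intro mult_mono) simp_all
  also have "\<dots> = \<rho>" using u by simp
  finally have \<delta>': "2 * w 1 ^ Suc L * \<delta> \<le> \<rho>" unfolding u_def .
  define c where "c = \<delta> * ln 2 / (2 * real L)"
  have c: "c > 0" using \<delta> L by (simp add: c_def)
  have bound: "measure_pmf.prob (sgt_with_vertex w n) {(T, v). k \<le> protection_number T v}
      \<le> 3 * exp (- c * real k)" if n: "2 * Suc L \<le> n" "sgt_defined w n" for n k
  proof (cases "k \<le> n")
    case True
    let ?T = "\<Sum>s\<in>degree_sequences n. seq_weight w s"
    have "?T \<ge> 0" by (intro sum_nonneg seq_weight_nonneg w)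
    have "measure_pmf.prob (sgt_with_vertex w n) {(T, v). k \<le> protection_number T v}
      \<le> (\<Sum>s | s \<in> degree_sequences n \<and> 0 \<notin> set (take k s). seq_weight w s) / ?T"
      by (rule prob_protection_number_le[OF assms(1) n(2)])
    also have "\<dots> \<le> 3 * exp (- c * real k) * ?T / ?T"
      using sum_nonzero_prefix_exp_bound[OF w L(1) True _ \<delta>(2) _ w0 L(2) n(1)] \<delta>(1) \<delta>' \<open>?T \<ge> 0\<close>
      by (intro divide_right_mono) (auto simp: c_def \<rho>_def)
    \<comment> \<open>For \<open>?T = 0\<close> the left side is 0 by the convention for
      division.\<close>
    also have "\<dots> \<le> 3 * exp (- c * real k)" by simp
    finally show ?thesis .
  next
    case False
    \<comment> \<open>For k > n the prefix is the whole list, which must contain a zero.\<close>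
    have "{s. s \<in> degree_sequences n \<and> 0 \<notin> set (take k s)} = {}"
      using False zero_in_degree_sequence[of _ n] by (auto simp: degree_sequences_def)
    with prob_protection_number_le[OF assms(1) n(2), of k] have
      "measure_pmf.prob (sgt_with_vertex w n) {(T, v). k \<le> protection_number T v} \<le> 0"
      by (simp only: sum.empty div_0)
    also have "0 \<le> 3 * exp (- c * real k)" by simp
    finally show ?thesis .
  qed
  show ?thesis
    \<comment> \<open>From this order on, a prefix of \<open>Suc L\<close> ones fits into the first
      half of the list.\<close>
    by (rule exI[of _ "2 * Suc L"], rule exI[of _ 3], rule exI[of _ c]) (use bound c in auto)
qed

end
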